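(* Let $\rho>0$, $\beta>0$, $x_0>0$, and let $x_{i+1}=a_ix_i+b_i$ be the linear stochastic recursion described in the context. Assume that $\mathbb{E}[b_0]<\infty$. Then $$\lim_{n\to\infty}\frac1n\log x_n=\log(1+\rho)$$ almost surely, the limit being taken with $\beta=\frac12\sigma^2\tau n^2$ held fixed.
   Context: Setup: for each $n\ge1$ the parameters $\sigma=\sigma_n>0$ and $\tau=\tau_n>0$ satisfy $\frac12\sigma_n^2\tau_n n^2=\beta$, with $\beta$ fixed. $W(t)$ is a standard Brownian motion started at $0$ at time $0$ (the same for all $n$), $t_i=i\tau$, $W_i=W(t_i)$, and $a_i=1+\rho e^{\sigma W_i-\frac12\sigma^2t_i}$. The $b_i$, $i\ge0$, are i.i.d. positive random variables (the same sequence for all $n$), independent of $(a_i)_{i\ge0}$. The process is $x_{i+1}=a_ix_i+b_i$ with deterministic initial value $x_0>0$, and $x_n$ is computed with parameters $\sigma_n,\tau_n$. *)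

theory Defs
  imports "HOL-Probability.Probability"
begin

text \<open>
  The filtration-free definition of standard Brownian motion on the time set \<open>t \<ge> 0\<close>.
  The values of \<open>W\<close> at negative times are unconstrained.  The starting value and the
  continuity of the paths are only required almost surely.
\<close>

locale standard_brownian_motion = prob_space M
  for M :: "'a measure" and W :: "real \<Rightarrow> 'a \<Rightarrow> real" +
  assumes measurable_W: "\<And>t. 0 \<le> t \<Longrightarrow> W t \<in> borel_measurable M"
    and start: "AE \<omega> in M. W 0 \<omega> = 0"
    and independent_increments:
      "\<And>(t :: nat \<Rightarrow> real) k. 0 \<le> t 0 \<Longrightarrow> (\<And>i. i < k \<Longrightarrow> t i < t (Suc i)) \<Longrightarrow>
         indep_vars (\<lambda>_. borel) (\<lambda>i \<omega>. W (t (Suc i)) \<omega> - W (t i) \<omega>) {..<k}"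
    and gaussian_increments:
      "\<And>s t. 0 \<le> s \<Longrightarrow> s < t \<Longrightarrow>
         distributed M lborel (\<lambda>\<omega>. W t \<omega> - W s \<omega>) (normal_density 0 (sqrt (t - s)))"
    and continuous_paths: "AE \<omega> in M. continuous_on {0..} (\<lambda>t. W t \<omega>)"

definition iid_seq :: "'a measure \<Rightarrow> (nat \<Rightarrow> 'a \<Rightarrow> real) \<Rightarrow> bool" where
  "iid_seq M b \<longleftrightarrow>
     prob_space.indep_vars M (\<lambda>_. borel) b UNIV \<and>
     (\<forall>i. distr M borel (b i) = distr M borel (b 0))"

text \<open>Independence of two sequences as random elements of the product space of sequences,
  that is, independence of the \<open>\<sigma>\<close>-algebras they generate.\<close>

definition indep_seqs :: "'a measure \<Rightarrow> (nat \<Rightarrow> 'a \<Rightarrow> real) \<Rightarrow> (nat \<Rightarrow> 'a \<Rightarrow> real) \<Rightarrow> bool" where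
  "indep_seqs M b a \<longleftrightarrow>
     prob_space.indep_var M
       (Pi\<^sub>M UNIV (\<lambda>_. borel)) (\<lambda>\<omega> i. b i \<omega>)
       (Pi\<^sub>M UNIV (\<lambda>_. borel)) (\<lambda>\<omega> i. a i \<omega>)"

definition multiplier ::
    "(real \<Rightarrow> 'a \<Rightarrow> real) \<Rightarrow> real \<Rightarrow> real \<Rightarrow> real \<Rightarrow> nat \<Rightarrow> 'a \<Rightarrow> real" where
  "multiplier W \<rho> \<sigma> \<tau> i \<omega> =
     1 + \<rho> * exp (\<sigma> * W (real i * \<tau>) \<omega> - 1 / 2 * \<sigma>\<^sup>2 * (real i * \<tau>))"

primrec linear_recursion ::
    "(nat \<Rightarrow> 'a \<Rightarrow> real) \<Rightarrow> (nat \<Rightarrow> 'a \<Rightarrow> real) \<Rightarrow> real \<Rightarrow> nat \<Rightarrow> 'a \<Rightarrow> real" where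
  "linear_recursion a b x\<^sub>0 0 \<omega> = x\<^sub>0"
| "linear_recursion a b x\<^sub>0 (Suc i) \<omega> = a i \<omega> * linear_recursion a b x\<^sub>0 i \<omega> + b i \<omega>"

end

theory Submission
  imports Defs
begin

text \<open>
  After \<open>n\<close> steps the recursion uses the multipliers \<open>1 + \<rho> e\<^bsup>z\<^esup>\<close> with exponents
  \<open>z = \<sigma> W(i\<tau>) - \<sigma>\<^sup>2 i\<tau> / 2\<close>, \<open>i < n\<close>.  Keeping \<open>\<sigma>\<^sup>2 \<tau> n\<^sup>2 = 2\<beta>\<close> fixed makes the Gaussian part of
  every exponent have variance at most \<open>2\<beta> / n\<close> and the drift at most \<open>\<beta> / n\<close>, so all
  exponents should tend to \<open>0\<close> uniformly in \<open>i < n\<close> and the recursion should grow like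
  \<open>(1 + \<rho>)\<^sup>n\<close>.

  The uniformity is obtained from the sixth powers.  The sum \<open>S n\<close> over \<open>i < n\<close> of
  \<open>(\<sigma> W(i\<tau>))\<^sup>6\<close> has expectation at most \<open>n \<cdot> 15 (2\<beta> / n)\<^sup>3 = O(1 / n\<^sup>2)\<close>.  This is summable in
  \<open>n\<close>, so \<open>S n \<longlonglongrightarrow> 0\<close> almost surely (\<open>AE_multiplier_exponents_small\<close>), and the sixth root of
  \<open>S n\<close> bounds all Gaussian parts at once.  Sixth powers are the lowest even powers that work:
  fourth powers would only give \<open>O(1 / n)\<close>.  Only the first moment of each \<open>S n\<close> enters, so the
  argument is insensitive to the joint law of different \<open>n\<close>.

  The inhomogeneity contributes only a bounded factor.  As \<open>E b\<^sub>i\<close> is finite and does not depend on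
  \<open>i\<close>, the series of the \<open>b\<^sub>i / (1 + \<rho>)\<^sup>i\<close> has finite expectation and so converges almost surely, to
  \<open>C\<close> say.  If \<open>e n\<close> bounds the exponents, comparison with constant multipliers gives
  \<open>x\<^sub>0 (1 + \<rho> e\<^bsup>- e n\<^esup>)\<^sup>n \<le> x\<^sub>n \<le> (x\<^sub>0 + C) (1 + \<rho> e\<^bsup>e n\<^esup>)\<^sup>n\<close>
  (\<open>linear_recursion_ge_power\<close> and \<open>linear_recursion_le_power\<close>), and the theorem
  follows by taking logarithms and dividing by \<open>n\<close>.
\<close>

section \<open>Almost sure convergence from first moments\<close>

text \<open>The first-moment form of the Borel-Cantelli lemma: the sum of the series has finite
  expectation, hence is almost surely finite.  It is applied to the discounted inhomogeneity and to
  the sums of sixth powers of \<open>\<sigma> W(i\<tau>)\<close>.\<close>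

lemma AE_summable_abs_of_summable_expectation:
  fixes f :: "nat \<Rightarrow> 'a \<Rightarrow> real"
  assumes int: "\<And>n. integrable M (f n)"
    and sum: "summable (\<lambda>n. \<integral>\<omega>. \<bar>f n \<omega>\<bar> \<partial>M)"
  shows "AE \<omega> in M. summable (\<lambda>n. \<bar>f n \<omega>\<bar>)"
proof -
  have [measurable]: "f n \<in> borel_measurable M" for n
    using int by auto
  have "(\<integral>\<^sup>+\<omega>. (\<Sum>n. ennreal \<bar>f n \<omega>\<bar>) \<partial>M) = (\<Sum>n. \<integral>\<^sup>+\<omega>. ennreal \<bar>f n \<omega>\<bar> \<partial>M)"
    by (intro nn_integral_suminf) measurable
  also have "\<dots> = (\<Sum>n. ennreal (\<integral>\<omega>. \<bar>f n \<omega>\<bar> \<partial>M))"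
    by (intro suminf_cong nn_integral_eq_integral) (use int in auto)
  also have "\<dots> = ennreal (\<Sum>n. \<integral>\<omega>. \<bar>f n \<omega>\<bar> \<partial>M)"
    by (intro suminf_ennreal2 sum) simp
  finally have "(\<integral>\<^sup>+\<omega>. (\<Sum>n. ennreal \<bar>f n \<omega>\<bar>) \<partial>M) \<noteq> \<infinity>"
    by simp
  then have "AE \<omega> in M. (\<Sum>n. ennreal \<bar>f n \<omega>\<bar>) \<noteq> \<infinity>"
    by (intro nn_integral_noteq_infinite) auto
  then show ?thesis
    by eventually_elim (auto intro: summable_suminf_not_top)
qed

text \<open>Equality of the laws gives \<open>E \<bar>b i\<bar> = E \<bar>b 0\<bar>\<close>, so the expectations of the discounted
  terms form a convergent geometric series.\<close>

lemma AE_summable_discounted_identically_distributed: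
  fixes b :: "nat \<Rightarrow> 'a \<Rightarrow> real"
  assumes meas [measurable]: "\<And>i. b i \<in> borel_measurable M"
    and distr: "\<And>i. distr M borel (b i) = distr M borel (b 0)"
    and int: "integrable M (b 0)" and "1 < r"
  shows "AE \<omega> in M. summable (\<lambda>i. \<bar>b i \<omega> / r ^ i\<bar>)"
proof (rule AE_summable_abs_of_summable_expectation)
  have int_b: "integrable M (b i)" for i
  proof -
    have "integrable (distr M borel (b 0)) (\<lambda>x. x)"
      using int by (subst integrable_distr_eq) auto
    then have "integrable (distr M borel (b i)) (\<lambda>x. x)"
      by (simp only: distr[of i])
    then show ?thesis
      by (subst (asm) integrable_distr_eq) auto
  qed
  then show "integrable M (\<lambda>\<omega>. b i \<omega> / r ^ i)" for i
    by simp
  have mean: "(\<integral>\<omega>. \<bar>b i \<omega>\<bar> \<partial>M) = (\<integral>\<omega>. \<bar>b 0 \<omega>\<bar> \<partial>M)" for i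
  proof -
    have law: "(\<integral>\<omega>. \<bar>b k \<omega>\<bar> \<partial>M) = (\<integral>x. \<bar>x\<bar> \<partial>distr M borel (b k))" for k
      by (rule integral_distr[symmetric]) auto
    show ?thesis
      by (simp only: law distr[of i])
  qed
  have "(\<integral>\<omega>. \<bar>b i \<omega> / r ^ i\<bar> \<partial>M) = (\<integral>\<omega>. \<bar>b 0 \<omega>\<bar> \<partial>M) * (1 / r) ^ i" for i
    using \<open>1 < r\<close> by (simp add: mean[of i] power_divide abs_divide)
  then show "summable (\<lambda>i. \<integral>\<omega>. \<bar>b i \<omega> / r ^ i\<bar> \<partial>M)"
    using \<open>1 < r\<close> by (simp add: summable_mult)
qed

section \<open>Uniform smallness of the exponents\<close>

text \<open>For \<open>t > 0\<close> this is the sixth moment of the Gaussian increment \<open>W t - W 0\<close>; the time \<open>t = 0\<close>, at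
  which the first multiplier is taken, has to be treated apart.\<close>

lemma (in standard_brownian_motion) sixth_moment:
  assumes "0 \<le> t"
  shows "integrable M (\<lambda>\<omega>. W t \<omega> ^ 6)" and "(\<integral>\<omega>. W t \<omega> ^ 6 \<partial>M) = 15 * t ^ 3"
proof -
  note [measurable] = measurable_W[OF assms] measurable_W[OF order_refl]
  have "has_bochner_integral M (\<lambda>\<omega>. (W t \<omega> - W 0 \<omega>) ^ 6) (15 * t ^ 3)"
  proof (cases "t = 0")
    case True
    then show ?thesis by (simp add: has_bochner_integral_zero)
  next
    case False
    with assms have t: "0 < t" by simp
    note D = gaussian_increments[OF order_refl t, simplified]
    have N: "has_bochner_integral lborel (\<lambda>x. normal_density 0 (sqrt t) x * x ^ 6) (15 * t ^ 3)"
      using normal_moment_even[of "sqrt t" 0 3] t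
      by (simp add: fact_numeral power_divide divide_simps mult_ac)
    have "integrable M (\<lambda>\<omega>. (W t \<omega> - W 0 \<omega>) ^ 6)"
      using N by (subst distributed_integrable[OF D, of "\<lambda>x. x ^ 6", symmetric])
        (auto simp: has_bochner_integral_iff)
    moreover have "(\<integral>\<omega>. (W t \<omega> - W 0 \<omega>) ^ 6 \<partial>M) = 15 * t ^ 3"
      using N by (subst distributed_integral[OF D, of "\<lambda>x. x ^ 6", symmetric])
        (auto simp: has_bochner_integral_iff)
    ultimately show ?thesis
      by (simp add: has_bochner_integral_iff)
  qed
  moreover have "AE \<omega> in M. (W t \<omega> - W 0 \<omega>) ^ 6 = W t \<omega> ^ 6"
    using start by eventually_elim simp
  ultimately have "has_bochner_integral M (\<lambda>\<omega>. W t \<omega> ^ 6) (15 * t ^ 3)"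
    by (subst has_bochner_integral_cong_AE[symmetric]) auto
  then show "integrable M (\<lambda>\<omega>. W t \<omega> ^ 6)" and "(\<integral>\<omega>. W t \<omega> ^ 6 \<partial>M) = 15 * t ^ 3"
    by (auto simp: has_bochner_integral_iff)
qed

text \<open>The probabilistic core.  The bound \<open>e n\<close> is the sixth root of \<open>S n\<close> plus the largest possible
  drift \<open>\<beta> / n\<close>; it depends on the path.\<close>

lemma (in standard_brownian_motion) AE_multiplier_exponents_small:
  fixes \<sigma> \<tau> :: "nat \<Rightarrow> real"
  assumes \<tau>: "\<And>n. n \<ge> 1 \<Longrightarrow> \<tau> n > 0"
    and \<beta>: "\<And>n. n \<ge> 1 \<Longrightarrow> 1 / 2 * (\<sigma> n)\<^sup>2 * \<tau> n * (real n)\<^sup>2 = \<beta>"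
  shows "AE \<omega> in M. \<exists>e. e \<longlonglongrightarrow> 0 \<and>
    (\<forall>n. \<forall>i<n. \<bar>\<sigma> n * W (real i * \<tau> n) \<omega> - 1 / 2 * (\<sigma> n)\<^sup>2 * (real i * \<tau> n)\<bar> \<le> e n)"
proof -
  define S where "S n \<omega> = (\<Sum>i<n. (\<sigma> n * W (real i * \<tau> n) \<omega>) ^ 6)" for n \<omega>
  have time_nonneg: "0 \<le> real i * \<tau> n" if "i < n" for i n
    using \<tau>[of n] that by simp
  have variance_bound: "(\<sigma> n)\<^sup>2 * (real i * \<tau> n) \<le> 2 * \<beta> / real n" if "i < n" for i n
  proof -
    have "(\<sigma> n)\<^sup>2 * (real i * \<tau> n) \<le> (\<sigma> n)\<^sup>2 * (real n * \<tau> n)"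
      using that \<tau>[of n] by (intro mult_left_mono mult_right_mono) auto
    also have "\<dots> = 2 * \<beta> / real n"
      using \<beta>[of n] that by (simp add: field_simps power2_eq_square)
    finally show ?thesis .
  qed
  have int_term: "integrable M (\<lambda>\<omega>. (\<sigma> n * W (real i * \<tau> n) \<omega>) ^ 6)" if "i < n" for i n
    using sixth_moment(1)[OF time_nonneg[OF that]] by (simp add: power_mult_distrib)
  have int_S: "integrable M (S n)" for n
    unfolding S_def by (intro Bochner_Integration.integrable_sum int_term) simp
  have S_nonneg: "0 \<le> S n \<omega>" for n \<omega>
    unfolding S_def by (intro sum_nonneg) (simp add: zero_le_even_power)
  have moment_S: "(\<integral>\<omega>. \<bar>S n \<omega>\<bar> \<partial>M) \<le> 120 * \<beta> ^ 3 * (1 / real n ^ 2)" for n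
  proof -
    have "(\<integral>\<omega>. \<bar>S n \<omega>\<bar> \<partial>M) = (\<integral>\<omega>. S n \<omega> \<partial>M)"
      using S_nonneg by simp
    also have "\<dots> = (\<Sum>i<n. \<integral>\<omega>. (\<sigma> n * W (real i * \<tau> n) \<omega>) ^ 6 \<partial>M)"
      unfolding S_def by (intro Bochner_Integration.integral_sum int_term) simp
    also have "\<dots> = (\<Sum>i<n. 15 * ((\<sigma> n)\<^sup>2 * (real i * \<tau> n)) ^ 3)"
      by (intro sum.cong refl)
        (simp add: power_mult_distrib sixth_moment(2)[OF time_nonneg] flip: power_mult)
    also have "\<dots> \<le> (\<Sum>i<n. 15 * (2 * \<beta> / real n) ^ 3)"
      using variance_bound time_nonneg by (intro sum_mono mult_left_mono power_mono) auto
    also have "\<dots> = 120 * \<beta> ^ 3 * (1 / real n ^ 2)"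
      by (cases "n = 0") (simp_all add: field_simps power2_eq_square power3_eq_cube)
    finally show ?thesis .
  qed
  have "summable (\<lambda>n. 120 * \<beta> ^ 3 * (1 / real n ^ 2))"
    using inverse_power_summable[of 2, where ?'a = real]
    by (intro summable_mult) (simp add: inverse_eq_divide)
  then have "summable (\<lambda>n. \<integral>\<omega>. \<bar>S n \<omega>\<bar> \<partial>M)"
    by (rule summable_comparison_test') (use moment_S in simp)
  then have "AE \<omega> in M. summable (\<lambda>n. \<bar>S n \<omega>\<bar>)"
    by (intro AE_summable_abs_of_summable_expectation int_S)
  then show ?thesis
  proof eventually_elim
    case (elim \<omega>)
    define e where "e n = root 6 (S n \<omega>) + \<beta> / real n" for n
    have "(\<lambda>n. S n \<omega>) \<longlonglongrightarrow> 0"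
      using summable_LIMSEQ_zero[OF elim] by (simp add: tendsto_rabs_zero_iff)
    then have "(\<lambda>n. root 6 (S n \<omega>)) \<longlonglongrightarrow> 0"
      using tendsto_real_root by fastforce
    moreover have "(\<lambda>n. \<beta> / real n) \<longlonglongrightarrow> 0"
      by (rule lim_const_over_n)
    ultimately have "e \<longlonglongrightarrow> 0"
      unfolding e_def by (rule tendsto_add_zero)
    moreover have "\<bar>\<sigma> n * W (real i * \<tau> n) \<omega> - 1 / 2 * (\<sigma> n)\<^sup>2 * (real i * \<tau> n)\<bar> \<le> e n"
      if i: "i < n" for i n
    proof -
      let ?z = "\<sigma> n * W (real i * \<tau> n) \<omega>"
      have "?z ^ 6 \<le> S n \<omega>"
        unfolding S_def using i
        by (intro member_le_sum[where f = "\<lambda>i. (\<sigma> n * W (real i * \<tau> n) \<omega>) ^ 6"])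
          (auto simp: zero_le_even_power)
      then have "root 6 (\<bar>?z\<bar> ^ 6) \<le> root 6 (S n \<omega>)"
        by (simp add: power_even_abs)
      then have "\<bar>?z\<bar> \<le> root 6 (S n \<omega>)"
        by (subst (asm) real_root_power_cancel) auto
      moreover have "0 \<le> (\<sigma> n)\<^sup>2 * (real i * \<tau> n)"
        using time_nonneg[OF i] by simp
      ultimately show ?thesis
        using variance_bound[OF i] unfolding e_def by simp
    qed
    ultimately show ?case by blast
  qed
qed

section \<open>Growth of the recursion along a path\<close>

lemma linear_recursion_ge_power:
  assumes "0 \<le> x\<^sub>0" and "0 \<le> q" and "\<And>i. i < n \<Longrightarrow> q \<le> a i \<omega>" and "\<And>i. i < n \<Longrightarrow> 0 \<le> b i \<omega>"
  shows "x\<^sub>0 * q ^ n \<le> linear_recursion a b x\<^sub>0 n \<omega>"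
  using assms(3,4)
proof (induction n)
  case 0
  then show ?case by simp
next
  case (Suc n)
  have "x\<^sub>0 * q ^ Suc n = q * (x\<^sub>0 * q ^ n)" by simp
  also have "\<dots> \<le> a n \<omega> * linear_recursion a b x\<^sub>0 n \<omega>"
    using Suc assms(1,2) order_trans[OF assms(2) Suc.prems(1)[of n]] by (intro mult_mono) auto
  also have "\<dots> \<le> linear_recursion a b x\<^sub>0 (Suc n) \<omega>"
    using Suc.prems(2)[of n] by simp
  finally show ?case .
qed

text \<open>The weights \<open>r ^ i\<close> with a fixed \<open>r \<le> A\<close>, in place of the powers \<open>A ^ Suc i\<close> that solving the
  recursion exactly would give, make the bracket independent of \<open>A\<close>; later \<open>A\<close> varies with \<open>n\<close>
  while \<open>r = 1 + \<rho>\<close> does not.\<close>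

lemma linear_recursion_le_power:
  assumes "0 \<le> x\<^sub>0" and "1 \<le> r" and "r \<le> A"
    and "\<And>i. i < n \<Longrightarrow> 0 \<le> a i \<omega>" and "\<And>i. i < n \<Longrightarrow> a i \<omega> \<le> A" and "\<And>i. i < n \<Longrightarrow> 0 \<le> b i \<omega>"
  shows "linear_recursion a b x\<^sub>0 n \<omega> \<le> A ^ n * (x\<^sub>0 + (\<Sum>i<n. b i \<omega> / r ^ i))"
  using assms(4-6)
proof (induction n)
  case 0
  then show ?case by simp
next
  case (Suc n)
  let ?C = "x\<^sub>0 + (\<Sum>i<n. b i \<omega> / r ^ i)"
  have "0 \<le> A" using assms(2,3) by simp
  have "0 \<le> ?C"
    using assms(1,2) Suc.prems(3) by (intro add_nonneg_nonneg sum_nonneg divide_nonneg_nonneg) auto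
  have "linear_recursion a b x\<^sub>0 n \<omega> \<le> A ^ n * ?C"
    using Suc by simp
  then have "a n \<omega> * linear_recursion a b x\<^sub>0 n \<omega> \<le> a n \<omega> * (A ^ n * ?C)"
    using Suc.prems(1)[of n] by (intro mult_left_mono) auto
  also have "\<dots> \<le> A * (A ^ n * ?C)"
    using Suc.prems(2)[of n] \<open>0 \<le> A\<close> \<open>0 \<le> ?C\<close> by (intro mult_right_mono) auto
  finally have "a n \<omega> * linear_recursion a b x\<^sub>0 n \<omega> \<le> A ^ Suc n * ?C"
    by simp
  moreover have "b n \<omega> \<le> A ^ Suc n * (b n \<omega> / r ^ n)"
  proof -
    have "r ^ n \<le> A ^ n"
      using assms(2,3) by (intro power_mono) auto
    also have "\<dots> \<le> A ^ Suc n"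
      using assms(2,3) by (intro power_increasing) auto
    finally have "b n \<omega> * r ^ n \<le> b n \<omega> * A ^ Suc n"
      using Suc.prems(3)[of n] by (intro mult_left_mono) auto
    then show ?thesis
      using assms(2) by (simp add: field_simps)
  qed
  ultimately show ?case
    by (simp add: distrib_left algebra_simps)
qed

text \<open>The comparison bounds differ from \<open>n\<close>-th powers only by the factors \<open>x\<^sub>0\<close> and \<open>x\<^sub>0 + C\<close>, which do
  not depend on \<open>n\<close>.  After taking logarithms and dividing by \<open>n\<close> their contribution vanishes, and the
  bases of the two powers are squeezed together because \<open>e n\<close> tends to \<open>0\<close>.\<close>

lemma linear_recursion_growth_rate:
  fixes a z :: "nat \<Rightarrow> nat \<Rightarrow> 'a \<Rightarrow> real"
  assumes "\<rho> > 0" and "x\<^sub>0 > 0"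
    and a: "\<And>n i. a n i \<omega> = 1 + \<rho> * exp (z n i \<omega>)"
    and z: "\<And>n i. i < n \<Longrightarrow> \<bar>z n i \<omega>\<bar> \<le> e n" and e: "e \<longlonglongrightarrow> 0"
    and b: "\<And>i. 0 \<le> b i \<omega>" and sum: "summable (\<lambda>i. b i \<omega> / (1 + \<rho>) ^ i)"
  shows "(\<lambda>n. 1 / real n * ln (linear_recursion (a n) b x\<^sub>0 n \<omega>)) \<longlonglongrightarrow> ln (1 + \<rho>)"
proof -
  define C where "C = (\<Sum>i. b i \<omega> / (1 + \<rho>) ^ i)"
  define X where "X n = linear_recursion (a n) b x\<^sub>0 n \<omega>" for n
  have C_nonneg: "0 \<le> C"
    unfolding C_def using b \<open>\<rho> > 0\<close> sum by (intro suminf_nonneg) auto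
  have factor_pos: "0 < 1 + \<rho> * exp y" for y
    using \<open>\<rho> > 0\<close> by (intro add_pos_pos mult_pos_pos) auto
  have ge: "x\<^sub>0 * (1 + \<rho> * exp (- e n)) ^ n \<le> X n" for n
    unfolding X_def
  proof (rule linear_recursion_ge_power)
    show "1 + \<rho> * exp (- e n) \<le> a n i \<omega>" if "i < n" for i
      using z[OF that] \<open>\<rho> > 0\<close> by (simp add: a abs_le_iff)
  qed (use b \<open>x\<^sub>0 > 0\<close> factor_pos[THEN less_imp_le] in auto)
  have le: "X n \<le> (1 + \<rho> * exp (e n)) ^ n * (x\<^sub>0 + C)" if "n \<ge> 1" for n
  proof -
    have "0 \<le> e n"
      using z[of 0 n] that by force
    have "X n \<le> (1 + \<rho> * exp (e n)) ^ n * (x\<^sub>0 + (\<Sum>i<n. b i \<omega> / (1 + \<rho>) ^ i))"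
      unfolding X_def
    proof (rule linear_recursion_le_power)
      show "1 + \<rho> \<le> 1 + \<rho> * exp (e n)"
        using \<open>\<rho> > 0\<close> \<open>0 \<le> e n\<close> by simp
      show "a n i \<omega> \<le> 1 + \<rho> * exp (e n)" if "i < n" for i
        using z[OF that] \<open>\<rho> > 0\<close> by (simp add: a abs_le_iff)
      show "0 \<le> a n i \<omega>" for i
        using factor_pos[of "z n i \<omega>"] by (simp add: a)
    qed (use b assms(1,2) in auto)
    also have "\<dots> \<le> (1 + \<rho> * exp (e n)) ^ n * (x\<^sub>0 + C)"
      unfolding C_def using b \<open>\<rho> > 0\<close> sum factor_pos[THEN less_imp_le]
      by (intro mult_left_mono add_left_mono sum_le_suminf zero_le_power) auto
    finally show ?thesis .
  qed
  have X_pos: "0 < X n" for n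
    using ge[of n] factor_pos \<open>x\<^sub>0 > 0\<close> by (meson less_le_trans mult_pos_pos zero_less_power)
  have ge_ln: "ln x\<^sub>0 / real n + ln (1 + \<rho> * exp (- e n)) \<le> 1 / real n * ln (X n)"
    if "n \<ge> 1" for n
  proof -
    have "ln (x\<^sub>0 * (1 + \<rho> * exp (- e n)) ^ n) \<le> ln (X n)"
      using ge[of n] factor_pos \<open>x\<^sub>0 > 0\<close> X_pos by (subst ln_le_cancel_iff) auto
    also have "ln (x\<^sub>0 * (1 + \<rho> * exp (- e n)) ^ n) = ln x\<^sub>0 + real n * ln (1 + \<rho> * exp (- e n))"
      using factor_pos \<open>x\<^sub>0 > 0\<close> by (subst ln_mult_pos) (auto simp: ln_realpow)
    finally have "(ln x\<^sub>0 + real n * ln (1 + \<rho> * exp (- e n))) / real n \<le> ln (X n) / real n"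
      by (rule divide_right_mono) simp
    then show ?thesis
      using that by (simp add: add_divide_distrib)
  qed
  have le_ln: "1 / real n * ln (X n) \<le> ln (x\<^sub>0 + C) / real n + ln (1 + \<rho> * exp (e n))"
    if "n \<ge> 1" for n
  proof -
    have "ln (X n) \<le> ln ((1 + \<rho> * exp (e n)) ^ n * (x\<^sub>0 + C))"
      using le[OF that] factor_pos \<open>x\<^sub>0 > 0\<close> C_nonneg X_pos
      by (subst ln_le_cancel_iff) (auto intro!: mult_pos_pos)
    also have "\<dots> = real n * ln (1 + \<rho> * exp (e n)) + ln (x\<^sub>0 + C)"
      using factor_pos \<open>x\<^sub>0 > 0\<close> C_nonneg by (subst ln_mult_pos) (auto simp: ln_realpow)
    finally have "ln (X n) / real n \<le> (real n * ln (1 + \<rho> * exp (e n)) + ln (x\<^sub>0 + C)) / real n"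
      by (rule divide_right_mono) simp
    then show ?thesis
      using that by (simp add: add_divide_distrib)
  qed
  have lim: "(\<lambda>n. c / real n + ln (1 + \<rho> * exp (s n))) \<longlonglongrightarrow> ln (1 + \<rho>)"
    if "s \<longlonglongrightarrow> 0" for c and s :: "nat \<Rightarrow> real"
  proof -
    have "(\<lambda>n. c / real n + ln (1 + \<rho> * exp (s n))) \<longlonglongrightarrow> 0 + ln (1 + \<rho> * exp 0)"
      using \<open>\<rho> > 0\<close> that by (intro tendsto_intros lim_const_over_n) auto
    then show ?thesis by simp
  qed
  have "(\<lambda>n. 1 / real n * ln (X n)) \<longlonglongrightarrow> ln (1 + \<rho>)"
  proof (rule tendsto_sandwich)
    show "\<forall>\<^sub>F n in sequentially. ln x\<^sub>0 / real n + ln (1 + \<rho> * exp (- e n)) \<le> 1 / real n * ln (X n)"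
      using ge_ln by (intro eventually_sequentiallyI[of 1])
    show "\<forall>\<^sub>F n in sequentially.
        1 / real n * ln (X n) \<le> ln (x\<^sub>0 + C) / real n + ln (1 + \<rho> * exp (e n))"
      using le_ln by (intro eventually_sequentiallyI[of 1])
    show "(\<lambda>n. ln x\<^sub>0 / real n + ln (1 + \<rho> * exp (- e n))) \<longlonglongrightarrow> ln (1 + \<rho>)"
      using lim[OF tendsto_minus[OF e, simplified]] .
    show "(\<lambda>n. ln (x\<^sub>0 + C) / real n + ln (1 + \<rho> * exp (e n))) \<longlonglongrightarrow> ln (1 + \<rho>)"
      using lim[OF e] .
  qed
  then show ?thesis
    unfolding X_def .
qed

section \<open>Almost sure growth rate\<close>

theorem theorem5:
  fixes M :: "'a measure"
    and W :: "real \<Rightarrow> 'a \<Rightarrow> real"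
    and b :: "nat \<Rightarrow> 'a \<Rightarrow> real"
    and \<sigma> \<tau> :: "nat \<Rightarrow> real"
    and \<rho> \<beta> x\<^sub>0 :: real
  assumes "standard_brownian_motion M W"
    and "\<rho> > 0" and "\<beta> > 0" and "x\<^sub>0 > 0"
    and "\<And>n. n \<ge> 1 \<Longrightarrow> \<sigma> n > 0"
    and "\<And>n. n \<ge> 1 \<Longrightarrow> \<tau> n > 0"
    and "\<And>n. n \<ge> 1 \<Longrightarrow> 1 / 2 * (\<sigma> n)\<^sup>2 * \<tau> n * (real n)\<^sup>2 = \<beta>"
    and "iid_seq M b"
    and "\<And>i. AE \<omega> in M. b i \<omega> > 0"
    and "\<And>n. n \<ge> 1 \<Longrightarrow> indep_seqs M b (multiplier W \<rho> (\<sigma> n) (\<tau> n))"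
    and "integrable M (b 0)"
  shows "AE \<omega> in M.
    (\<lambda>n. 1 / real n * ln (linear_recursion (multiplier W \<rho> (\<sigma> n) (\<tau> n)) b x\<^sub>0 n \<omega>))
      \<longlonglongrightarrow> ln (1 + \<rho>)"
proof -
  interpret standard_brownian_motion M W by fact
  have meas: "b i \<in> borel_measurable M" for i
    using \<open>iid_seq M b\<close> by (auto simp: iid_seq_def indep_vars_def)
  have distr: "distr M borel (b i) = distr M borel (b 0)" for i
    using \<open>iid_seq M b\<close> by (auto simp: iid_seq_def)
  have "AE \<omega> in M. summable (\<lambda>i. \<bar>b i \<omega> / (1 + \<rho>) ^ i\<bar>)"
    using \<open>integrable M (b 0)\<close> \<open>\<rho> > 0\<close>
    by (intro AE_summable_discounted_identically_distributed meas distr) auto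
  moreover have "AE \<omega> in M. \<forall>i. b i \<omega> > 0"
    using \<open>\<And>i. AE \<omega> in M. b i \<omega> > 0\<close> by (simp add: AE_all_countable)
  moreover have "AE \<omega> in M. \<exists>e. e \<longlonglongrightarrow> 0 \<and>
    (\<forall>n. \<forall>i<n. \<bar>\<sigma> n * W (real i * \<tau> n) \<omega> - 1 / 2 * (\<sigma> n)\<^sup>2 * (real i * \<tau> n)\<bar> \<le> e n)"
    by (intro AE_multiplier_exponents_small[where \<beta> = \<beta>] assms(6,7))
  ultimately show ?thesis
  proof eventually_elim
    case (elim \<omega>)
    then obtain e where "e \<longlonglongrightarrow> 0"
      and "\<And>n i. i < n \<Longrightarrow>
        \<bar>\<sigma> n * W (real i * \<tau> n) \<omega> - 1 / 2 * (\<sigma> n)\<^sup>2 * (real i * \<tau> n)\<bar> \<le> e n"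
      by blast
    moreover have "0 \<le> b i \<omega>" for i
      using elim(2) by (simp add: less_imp_le)
    moreover have "summable (\<lambda>i. b i \<omega> / (1 + \<rho>) ^ i)"
      using elim(1) by (rule summable_rabs_cancel)
    ultimately show ?case
      by (intro linear_recursion_growth_rate[OF assms(2,4),
            where z = "\<lambda>n i \<omega>. \<sigma> n * W (real i * \<tau> n) \<omega> - 1 / 2 * (\<sigma> n)\<^sup>2 * (real i * \<tau> n)"])
        (auto simp: multiplier_def)
  qed
qed

end
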